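(* Let $n\geq 5$. If $G$ is a graph on $n$ vertices such that both $G$ and $\overline{G}$ are connected, then $rvc(G)+rvc(\overline{G})\geq 2$. Moreover, this lower bound is best possible: for every $n\geq 5$ there exists a graph $G$ on $n$ vertices such that $G$ and $\overline{G}$ are both connected and $rvc(G)=rvc(\overline{G})=1$.
   Context: All graphs are finite, simple and undirected. A vertex-coloring of a graph (not necessarily proper) makes the graph rainbow vertex-connected if every pair of distinct vertices is joined by a path whose internal vertices have pairwise distinct colors. For a connected graph $G$, the rainbow vertex-connection number $rvc(G)$ is the minimum number of colors in a vertex-coloring making $G$ rainbow vertex-connected (so $rvc(G)=0$ exactly when $G$ is complete). $\overline{G}$ denotes the complement of $G$. *)

theory Defs
  imports "Graph_Theory.Kuratowski"
begin

text \<open>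
  A finite simple undirected graph is a \<^locale>\<open>pair_graph\<close>: finite, loop-free, and with a
  symmetric set of arcs, each edge being represented by both of its orientations.
\<close>

definition complement_graph :: "'a pair_pre_digraph \<Rightarrow> 'a pair_pre_digraph" where
  "complement_graph G =
     \<lparr> pverts = pverts G,
       parcs = {(u, v). u \<in> pverts G \<and> v \<in> pverts G \<and> u \<noteq> v \<and> (u, v) \<notin> parcs G} \<rparr>"

definition rainbow_vertex_connected :: "'a pair_pre_digraph \<Rightarrow> ('a \<Rightarrow> 'c) \<Rightarrow> bool" where
  "rainbow_vertex_connected G c \<longleftrightarrow>
     (\<forall>u \<in> pverts G. \<forall>v \<in> pverts G. u \<noteq> v \<longrightarrow>
        (\<exists>p. pre_digraph.apath (with_proj G) u p v \<and>
             distinct (map c (pre_digraph.inner_verts (with_proj G) p))))"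

text \<open>
  A total coloring of a nonempty vertex set uses at least one color. A complete graph needs no
  colors at all, since its vertices are pairwise joined by paths without internal vertices; its
  rainbow vertex-connection number is 0 by convention. For disconnected graphs the value is
  unspecified, as no suitable coloring exists.
\<close>

definition rvc :: "'a pair_pre_digraph \<Rightarrow> nat" where
  "rvc G =
     (if K\<^bsub>card (pverts G)\<^esub> (with_proj G) then 0
      else (LEAST k. \<exists>c :: 'a \<Rightarrow> nat.
              card (c ` pverts G) = k \<and> rainbow_vertex_connected G c))"

lemma pair_graph_complement_graph:
  assumes "pair_graph G"
  shows "pair_graph (complement_graph G)"
proof -
  interpret pair_graph G by fact
  have fin: "finite (pverts G \<times> pverts G)" by simp
  have "finite (parcs (complement_graph G))"
    by (rule finite_subset[OF _ fin]) (auto simp: complement_graph_def)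
  then show ?thesis
    by unfold_locales
      (auto simp: complement_graph_def symmetric_def intro!: symI dest: arcs_symmetric)
qed

lemma connected_pair_graph_iff:
  assumes "pair_graph G"
  shows "connected (with_proj G) \<longleftrightarrow> strongly_connected (with_proj G)"
proof -
  interpret pair_graph G by fact
  have "parcs (mk_symmetric (with_proj G)) = parcs G"
    by (auto simp: mk_symmetric_def intro: arcs_symmetric)
  moreover have "pverts (mk_symmetric (with_proj G)) = pverts G"
    by (simp add: mk_symmetric_def)
  ultimately have "mk_symmetric (with_proj G) = G" by simp
  then show ?thesis by (simp add: connected_def)
qed

lemma ex_rainbow_coloring:
  assumes "pair_graph G" "connected (with_proj G)"
  shows "\<exists>c :: 'a \<Rightarrow> nat. rainbow_vertex_connected (G :: 'a pair_pre_digraph) c"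
proof -
  interpret pair_graph G by fact
  obtain c :: "'a \<Rightarrow> nat" where c: "inj_on c (pverts G)"
    using finite_imp_inj_to_nat_seg[OF pair_finite_verts] by blast
  have sc: "strongly_connected (with_proj G)"
    using assms(2) by (simp add: connected_pair_graph_iff[OF assms(1)])
  have "\<exists>p. apath u p v \<and> distinct (map c (inner_verts p))"
    if uv: "u \<in> pverts G" "v \<in> pverts G" for u v
  proof -
    have "u \<rightarrow>\<^sup>*\<^bsub>with_proj G\<^esub> v"
      using sc uv by (simp add: strongly_connected_def)
    then obtain p where p: "apath u p v"
      by (metis reachable_apath)
    then have d: "distinct (pawalk_verts u p)" and w: "set (pawalk_verts u p) \<subseteq> pverts G"
      unfolding apath_def by (blast, blast elim: awalkE)
    have "set (inner_verts p) \<subseteq> set (pawalk_verts u p) \<and> distinct (inner_verts p)"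
    proof (cases p)
      case (Cons e es)
      then show ?thesis using d by (simp add: inner_verts_def awalk_verts_conv subset_insertI2) 
    qed (simp add: inner_verts_def)
    then have "set (inner_verts p) \<subseteq> pverts G" "distinct (inner_verts p)"
      using w by blast+
    with c have "distinct (map c (inner_verts p))"
      by (simp add: distinct_map inj_on_subset)
    with p show ?thesis by blast
  qed
  then show ?thesis
    unfolding rainbow_vertex_connected_def by blast
qed

lemma rvc_eq_0_iff:
  assumes "pair_graph G" "connected (with_proj G)"
  shows "rvc G = 0 \<longleftrightarrow> K\<^bsub>card (pverts G)\<^esub> (with_proj G)"
proof -
  interpret pair_graph G by fact
  let ?P = "\<lambda>k. \<exists>c :: 'a \<Rightarrow> nat. card (c ` pverts G) = k \<and> rainbow_vertex_connected G c"
  have "\<exists>k. ?P k" using ex_rainbow_coloring[OF assms] by blast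
  then have "?P (LEAST k. ?P k)" by (rule LeastI_ex)
  moreover have "pverts G \<noteq> {}"
    using assms(2) by (simp add: connected_pair_graph_iff[OF assms(1)] strongly_connected_def)
  ultimately have "(LEAST k. ?P k) \<noteq> 0"
    by (metis (no_types, lifting) card_0_eq finite_imageI image_is_empty pair_finite_verts)
  then show ?thesis by (simp add: rvc_def)
qed

end

theory Submission
  imports Defs
begin

text \<open>
  Only a complete graph has rainbow vertex-connection number 0, and its complement has no edges,
  so neither of two connected complementary graphs has number 0. For sharpness, any two vertices
  of a graph of diameter 2 are joined by a path with at most one inner vertex, so a single color
  suffices. The cycle on five vertices is self-complementary of diameter 2; replacing one of its
  vertices by an independent set keeps the diameter of the graph and of its complement equal to 2.
\<close>

lemma rainbow_vertex_connected_const: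
  assumes "pair_graph G"
    and diam: "\<And>u v. u \<in> pverts G \<Longrightarrow> v \<in> pverts G \<Longrightarrow> u \<noteq> v \<Longrightarrow> (u, v) \<notin> parcs G \<Longrightarrow>
                 \<exists>w. (u, w) \<in> parcs G \<and> (w, v) \<in> parcs G"
  shows "rainbow_vertex_connected G (\<lambda>_. c)"
  unfolding rainbow_vertex_connected_def
proof (intro ballI impI)
  interpret pair_graph G by fact
  fix u v assume uv: "u \<in> pverts G" "v \<in> pverts G" "u \<noteq> v"
  show "\<exists>p. apath u p v \<and> distinct (map (\<lambda>_. c) (inner_verts p))"
  proof (cases "(u, v) \<in> parcs G")
    case True
    then have "apath u [(u, v)] v \<and> distinct (map (\<lambda>_. c) (inner_verts [(u, v)]))"
      using uv by (simp add: apath_def awalk_Cons_iff awalk_Nil_iff inner_verts_def)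
    then show ?thesis by blast
  next
    case False
    with diam uv obtain w where w: "(u, w) \<in> parcs G" "(w, v) \<in> parcs G" by blast
    \<comment> \<open>\<open>apath\<close> demands distinct vertices: \<open>u\<close> and
      \<open>v\<close> differ by assumption, and the absence of loops separates \<open>w\<close>
      from both.\<close>
    then have "u \<noteq> w" "w \<noteq> v" by (auto dest: pair_no_loops)
    with w have "apath u [(u, w), (w, v)] v
        \<and> distinct (map (\<lambda>_. c) (inner_verts [(u, w), (w, v)]))"
      using uv by (simp add: apath_def awalk_Cons_iff awalk_Nil_iff inner_verts_def)
    then show ?thesis by blast
  qed
qed

text \<open>Rainbow paths are paths, so connectedness of the example and of its complement comes
  along with the coloring.\<close>

lemma connected_of_rainbow_vertex_connected:
  assumes "pair_graph G" "pverts G \<noteq> {}" "rainbow_vertex_connected G c"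
  shows "connected (with_proj G)"
proof -
  interpret pair_graph G by fact
  have "u \<rightarrow>\<^sup>*\<^bsub>with_proj G\<^esub> v" if "u \<in> pverts G" "v \<in> pverts G" for u v
  proof (cases "u = v")
    case True
    then show ?thesis using that by simp
  next
    case False
    then show ?thesis
      using assms(3) that unfolding rainbow_vertex_connected_def by (meson reachable_apath)
  qed
  then show ?thesis
    using assms(2) by (simp add: connected_pair_graph_iff[OF assms(1)] strongly_connected_def)
qed

text \<open>A constant coloring gives the upper bound, and non-completeness excludes 0. This serves
  the example and its complement alike.\<close>

lemma diameter_two_rvc:
  assumes G: "pair_graph G" and ne: "pverts G \<noteq> {}"
    and nc: "\<not> K\<^bsub>card (pverts G)\<^esub> (with_proj G)"
    and diam: "\<And>u v. u \<in> pverts G \<Longrightarrow> v \<in> pverts G \<Longrightarrow> u \<noteq> v \<Longrightarrow> (u, v) \<notin> parcs G \<Longrightarrow>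
                 \<exists>w. (u, w) \<in> parcs G \<and> (w, v) \<in> parcs G"
  shows "connected (with_proj G)" "rvc G = 1"
proof -
  have r: "rainbow_vertex_connected G (\<lambda>_. 0 :: nat)"
    using rainbow_vertex_connected_const[OF G diam] .
  show con: "connected (with_proj G)"
    using connected_of_rainbow_vertex_connected[OF G ne r] .
  have "card ((\<lambda>_. 0 :: nat) ` pverts G) = 1" using ne by (simp add: image_constant_conv)
  with r have "rvc G \<le> 1" unfolding rvc_def using nc
    by (auto intro!: Least_le exI[of _ "\<lambda>_. 0 :: nat"])
  moreover have "rvc G \<noteq> 0" using rvc_eq_0_iff[OF G con] nc by simp
  ultimately show "rvc G = 1" by simp
qed

text \<open>Makes a graph and its complement interchangeable, so that \<open>rvc_nonzero\<close>
  applies to both summands.\<close>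

lemma complement_graph_complement_graph:
  assumes "pair_graph G"
  shows "complement_graph (complement_graph G) = G"
proof -
  interpret pair_graph G by fact
  have "parcs (complement_graph (complement_graph G)) = parcs G"
    by (auto simp: complement_graph_def dest: pair_no_loops in_arcsD1 in_arcsD2)
  then show ?thesis by (simp add: complement_graph_def)
qed

lemma rvc_nonzero:
  assumes G: "pair_graph G" and card: "card (pverts G) \<ge> 2"
    and con: "connected (with_proj G)" "connected (with_proj (complement_graph G))"
  shows "rvc G \<noteq> 0"
proof
  assume "rvc G = 0"
  then have "parcs (complement_graph G) = {}"
    using rvc_eq_0_iff[OF G con(1)] by (auto simp: complete_digraph_pair_def complement_graph_def)
  moreover
  interpret C: pair_graph "complement_graph G" using G by (rule pair_graph_complement_graph)
  \<comment> \<open>The bound 2 on the order matters: a single vertex and its complement are both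
    connected with number 0.\<close>
  obtain u v where uv: "u \<in> pverts G" "v \<in> pverts G" "u \<noteq> v"
    using card by (meson card_le_Suc0_iff_eq card_2_iff' obtain_subset_with_card_n subsetD)
  then have "u \<rightarrow>\<^sup>*\<^bsub>with_proj (complement_graph G)\<^esub> v"
    using con(2) connected_pair_graph_iff[OF C.pair_graph_axioms]
    by (simp add: strongly_connected_def complement_graph_def)
  ultimately show False
    \<comment> \<open>Reaching a different vertex takes a first arc, and the complement has
      none.\<close>
    using uv(3) by (auto elim: C.converse_reachable_cases)
qed

definition C5_adj :: "nat \<Rightarrow> nat \<Rightarrow> bool" where
  "C5_adj a b \<longleftrightarrow>
     (a, b) \<in> {(0, 1), (1, 0), (1, 2), (2, 1), (2, 3), (3, 2), (3, 4), (4, 3), (4, 0), (0, 4)}"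

text \<open>The vertices \<open>4, \<dots>, n - 1\<close> are the copies of the vertex 4 of the cycle.\<close>

definition blown_up_C5 :: "nat \<Rightarrow> nat pair_pre_digraph" where
  "blown_up_C5 n =
     \<lparr> pverts = {..<n}, parcs = {(u, v). u < n \<and> v < n \<and> C5_adj (min u 4) (min v 4)} \<rparr>"

lemma pair_graph_blown_up_C5: "pair_graph (blown_up_C5 n)"
proof -
  have "finite (parcs (blown_up_C5 n))"
    by (rule finite_subset[of _ "{..<n} \<times> {..<n}"]) (auto simp: blown_up_C5_def)
  moreover have "C5_adj a b \<Longrightarrow> C5_adj b a" "\<not> C5_adj a a" for a b
    by (auto simp: C5_adj_def)
  ultimately show ?thesis
    by unfold_locales (auto simp: blown_up_C5_def symmetric_def intro!: symI)
qed

text \<open>The case \<open>a = b\<close> is included on purpose: two distinct copies of the vertex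
  4 are non-adjacent, collapse to the same vertex under \<open>min\<close>, and still need a common
  neighbor.\<close>

lemma C5_diameter:
  assumes "a \<le> 4" "b \<le> 4" "\<not> C5_adj a b"
  shows "\<exists>w\<le>4. C5_adj a w \<and> C5_adj w b"
proof -
  have "a \<in> {0, 1, 2, 3, 4}" "b \<in> {0, 1, 2, 3, 4}" using assms(1,2) by auto
  moreover have "C5_adj 0 1" "C5_adj 1 2" "C5_adj 2 3" "C5_adj 3 4" "C5_adj 4 0"
    "C5_adj 1 0" "C5_adj 2 1" "C5_adj 3 2" "C5_adj 4 3" "C5_adj 0 4"
    by (simp_all add: C5_adj_def)
  moreover have "0 \<le> (4::nat)" "1 \<le> (4::nat)" "2 \<le> (4::nat)" "3 \<le> (4::nat)" "4 \<le> (4::nat)"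
    by simp_all
  ultimately show ?thesis using assms(3) by blast
qed

text \<open>The vertex opposite an edge of the five-cycle is adjacent to neither end; the proof runs
  through the ten oriented edges.\<close>

lemma complement_C5_diameter:
  assumes "C5_adj a b"
  shows "\<exists>w\<le>4. w \<noteq> a \<and> w \<noteq> b \<and> \<not> C5_adj a w \<and> \<not> C5_adj w b"
proof -
  show ?thesis
    using assms unfolding C5_adj_def
    by (elim insertE emptyE; simp; presburger)
qed

lemma blown_up_C5_diameter:
  assumes "n \<ge> 5" "u < n" "v < n" "(u, v) \<notin> parcs (blown_up_C5 n)"
  shows "\<exists>w. (u, w) \<in> parcs (blown_up_C5 n) \<and> (w, v) \<in> parcs (blown_up_C5 n)"
proof -
  obtain w where "w \<le> 4" "C5_adj (min u 4) w" "C5_adj w (min v 4)"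
    using C5_diameter[of "min u 4" "min v 4"] assms by (auto simp: blown_up_C5_def)
  \<comment> \<open>As \<open>n \<ge> 5\<close>, the cycle vertex \<open>w\<close> is itself a
    vertex of the blow-up and represents itself: \<open>min w 4 = w\<close>.\<close>
  then show ?thesis using assms by (intro exI[of _ w]) (auto simp: blown_up_C5_def min_absorb1)
qed

lemma complement_blown_up_C5_diameter:
  assumes "n \<ge> 5" "u < n" "v < n" "(u, v) \<in> parcs (blown_up_C5 n)"
  shows "\<exists>w. (u, w) \<in> parcs (complement_graph (blown_up_C5 n))
           \<and> (w, v) \<in> parcs (complement_graph (blown_up_C5 n))"
proof -
  obtain w where "w \<le> 4" "w \<noteq> min u 4" "w \<noteq> min v 4"
      "\<not> C5_adj (min u 4) w" "\<not> C5_adj w (min v 4)"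
    using complement_C5_diameter[of "min u 4" "min v 4"] assms by (auto simp: blown_up_C5_def)
  \<comment> \<open>Complement arcs need distinct ends: with \<open>w \<le> 4\<close>, the
    inequality \<open>w \<noteq> min u 4\<close> yields \<open>w \<noteq> u\<close>, and likewise
    for \<open>v\<close>.\<close>
  then show ?thesis using assms
    by (intro exI[of _ w]) (auto simp: blown_up_C5_def complement_graph_def min_absorb1)
qed

theorem theorem3p1:
  fixes n :: nat
  assumes "n \<ge> 5"
  shows "(\<forall>G :: 'a pair_pre_digraph.
            pair_graph G \<and> card (pverts G) = n \<and>
            connected (with_proj G) \<and> connected (with_proj (complement_graph G))
            \<longrightarrow> rvc G + rvc (complement_graph G) \<ge> 2)
       \<and> (\<exists>H :: nat pair_pre_digraph.
            pair_graph H \<and> card (pverts H) = n \<and>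
            connected (with_proj H) \<and> connected (with_proj (complement_graph H)) \<and>
            rvc H = 1 \<and> rvc (complement_graph H) = 1)"
proof (intro conjI allI impI, elim conjE)
  fix G :: "'a pair_pre_digraph"
  assume G: "pair_graph G" "card (pverts G) = n"
    and con: "connected (with_proj G)" "connected (with_proj (complement_graph G))"
  have "pverts (complement_graph G) = pverts G" by (simp add: complement_graph_def)
  then have "rvc G \<noteq> 0" "rvc (complement_graph G) \<noteq> 0"
    using assms G con pair_graph_complement_graph[OF G(1)]
      complement_graph_complement_graph[OF G(1)]
      rvc_nonzero[of G] rvc_nonzero[of "complement_graph G"] by simp_all
  then show "rvc G + rvc (complement_graph G) \<ge> 2" by linarith
next
  let ?H = "blown_up_C5 n" and ?C = "complement_graph (blown_up_C5 n)"
  have H: "pair_graph ?H" by (rule pair_graph_blown_up_C5)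
  then have C: "pair_graph ?C" by (rule pair_graph_complement_graph)
  have vs: "pverts ?H = {..<n}" "pverts ?C = {..<n}"
    by (simp_all add: blown_up_C5_def complement_graph_def)
  have ne: "pverts ?H \<noteq> {}" "pverts ?C \<noteq> {}" using assms unfolding vs by (simp_all add: lessThan_empty_iff)
  \<comment> \<open>Vertices 0 and 2 are at distance two on the cycle and 0 and 1 are adjacent, so
    each graph misses one of these pairs.\<close>
  have "(0, 2) \<notin> parcs ?H" "(0, 1) \<notin> parcs ?C"
    using assms by (auto simp: blown_up_C5_def complement_graph_def C5_adj_def)
  \<comment> \<open>The sets have the shape of the full arc set in
    \<open>complete_digraph_pair_def\<close>, which completeness would equate with
    \<open>parcs\<close>.\<close>
  moreover have "(0, 2) \<in> {(u, v). (u, v) \<in> {..<n} \<times> {..<n} \<and> u \<noteq> v}"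
    "(0, 1) \<in> {(u, v). (u, v) \<in> {..<n} \<times> {..<n} \<and> u \<noteq> v}"
    using assms by simp_all
  ultimately have nc: "\<not> K\<^bsub>card (pverts ?H)\<^esub> (with_proj ?H)"
    "\<not> K\<^bsub>card (pverts ?C)\<^esub> (with_proj ?C)"
    unfolding complete_digraph_pair_def vs by metis+
  have dH: "\<exists>w. (u, w) \<in> parcs ?H \<and> (w, v) \<in> parcs ?H"
    if "u \<in> pverts ?H" "v \<in> pverts ?H" "u \<noteq> v" "(u, v) \<notin> parcs ?H" for u v
    using blown_up_C5_diameter[OF assms, of u v] that unfolding vs by blast
  have dC: "\<exists>w. (u, w) \<in> parcs ?C \<and> (w, v) \<in> parcs ?C"
    if uv: "u \<in> pverts ?C" "v \<in> pverts ?C" "u \<noteq> v" "(u, v) \<notin> parcs ?C" for u v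
  proof -
    \<comment> \<open>Distinct vertices that are not joined in the complement are joined in the
      graph itself.\<close>
    have "(u, v) \<in> parcs ?H" using uv vs by (auto simp: complement_graph_def)
    then show ?thesis
      using complement_blown_up_C5_diameter[OF assms, of u v] uv unfolding vs by blast
  qed
  show "\<exists>H :: nat pair_pre_digraph.
            pair_graph H \<and> card (pverts H) = n \<and>
            connected (with_proj H) \<and> connected (with_proj (complement_graph H)) \<and>
            rvc H = 1 \<and> rvc (complement_graph H) = 1"
    using H vs(1) diameter_two_rvc[OF H ne(1) nc(1) dH] diameter_two_rvc[OF C ne(2) nc(2) dC]
    by (intro exI[of _ ?H]) simp
qed

end
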